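(* Let $a<b$ and $c<d$ be integers and let $f(x,y)$ be a function of two variables whose partial derivatives up to second order are continuous in the rectangle $a\le x\le b$, $c\le y\le d$. Then $$\sum_{c<n\le d}\ \sum_{a<m\le b}f(m,n)=\int_a^b\!\int_c^d f(x,y)\,dy\,dx+\int_a^b\!\int_c^d f_x(x,y)(x-[x])\,dy\,dx+\int_a^b\!\int_c^d f_y(x,y)(y-[y])\,dy\,dx+\int_a^b\!\int_c^d f_{xy}(x,y)(x-[x])(y-[y])\,dy\,dx .$$
   Context: $[x]$ denotes the integral part (floor) of the real number $x$; $f_x,f_y,f_{xy}$ denote partial derivatives. In each double integral $x$ ranges over $[a,b]$ and $y$ over $[c,d]$; the sums run over integers $m,n$. *)

theory Defs
  imports "HOL-Analysis.Analysis"
begin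

text \<open>
  The derivatives are taken within the sides of the closed rectangle, hence are one-sided on its
  boundary; no values of the function outside the rectangle are involved. For nondegenerate
  rectangles \<open>gx\<close> and \<open>gy\<close> are uniquely determined by \<open>g\<close> on the rectangle.
\<close>

definition continuous_partials_on ::
  "(real \<Rightarrow> real \<Rightarrow> real) \<Rightarrow> (real \<Rightarrow> real \<Rightarrow> real) \<Rightarrow> (real \<Rightarrow> real \<Rightarrow> real) \<Rightarrow>
   real \<Rightarrow> real \<Rightarrow> real \<Rightarrow> real \<Rightarrow> bool" where
  "continuous_partials_on g gx gy a b c d \<longleftrightarrow>
     (\<forall>x\<in>{a..b}. \<forall>y\<in>{c..d}.
        ((\<lambda>s. g s y) has_real_derivative gx x y) (at x within {a..b}) \<and>
        ((\<lambda>t. g x t) has_real_derivative gy x y) (at y within {c..d})) \<and>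
     continuous_on ({a..b} \<times> {c..d}) (\<lambda>(x, y). gx x y) \<and>
     continuous_on ({a..b} \<times> {c..d}) (\<lambda>(x, y). gy x y)"

end

theory Submission
  imports Defs
begin

text \<open>
  On a unit interval \<open>[k, k + 1]\<close> the function \<open>g + g' (x - k)\<close> is the derivative of
  \<open>(x - k) g\<close>, which gives the one-dimensional summation formula
  \<open>\<Sum> g(m) = \<integral> (g + g' (x - [x]))\<close>. Apply it in \<open>y\<close> to \<open>f x\<close> and to \<open>f\<^sub>x x\<close>,
  then in \<open>x\<close> to \<open>\<Sum>\<^sub>n f x n\<close>, whose derivative is \<open>\<Sum>\<^sub>n f\<^sub>x x n\<close>.
\<close>

text \<open>The derivative \<open>g'\<close> may be discontinuous: the gauge integral integrates
  every derivative, so integrability comes out as part of the conclusion. Induction on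
  \<open>b\<close> appends one unit interval at a time.\<close>

lemma Euler_summation_has_integral:
  fixes a b :: int and g g' :: "real \<Rightarrow> real"
  assumes "a \<le> b"
    and "\<And>x. x \<in> {of_int a..of_int b} \<Longrightarrow>
           (g has_real_derivative g' x) (at x within {of_int a..of_int b})"
  shows "((\<lambda>x. g x + g' x * (x - of_int \<lfloor>x\<rfloor>)) has_integral (\<Sum>m\<in>{a<..b}. g (of_int m)))
           {of_int a..of_int b}"
  using assms
proof (induction b rule: int_ge_induct)
  case base
  show ?case by (simp add: has_integral_refl)
next
  case (step k)
  have left: "((\<lambda>x. g x + g' x * (x - of_int \<lfloor>x\<rfloor>)) has_integral (\<Sum>m\<in>{a<..k}. g (of_int m)))
           {of_int a..of_int k}"
  proof (rule step.IH)
    fix x :: real assume "x \<in> {of_int a..of_int k}"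
    then show "(g has_real_derivative g' x) (at x within {of_int a..of_int k})"
      by (intro DERIV_subset[OF step.prems]) auto
  qed
  \<comment> \<open>The antiderivative \<open>(x - k) * g x\<close> vanishes at \<open>k\<close> and
    equals \<open>g (k + 1)\<close> at \<open>k + 1\<close>. Hence only the right endpoint
    contributes, which matches the half-open range of summation.\<close>
  have "((\<lambda>x. g x + g' x * (x - of_int k)) has_integral
      (of_int (k + 1) - of_int k) * g (of_int (k + 1)) - (of_int k - of_int k) * g (of_int k))
      {of_int k..of_int (k + 1)}"
  proof (rule fundamental_theorem_of_calculus)
    fix x :: real assume x: "x \<in> {of_int k..of_int (k + 1)}"
    have "(g has_real_derivative g' x) (at x within {of_int k..of_int (k + 1)})"
      using x step.hyps by (intro DERIV_subset[OF step.prems]) auto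
    then have "((\<lambda>x. (x - of_int k) * g x) has_real_derivative g x + g' x * (x - of_int k))
        (at x within {of_int k..of_int (k + 1)})"
      by (auto intro!: derivative_eq_intros)
    then show "((\<lambda>x. (x - of_int k) * g x) has_vector_derivative g x + g' x * (x - of_int k))
        (at x within {of_int k..of_int (k + 1)})"
      by (simp only: has_real_derivative_iff_has_vector_derivative)
  qed simp
  \<comment> \<open>On the unit interval the floor differs from \<open>k\<close> only at the point
    \<open>k + 1\<close>, and a single point does not affect the integral.\<close>
  then have right: "((\<lambda>x. g x + g' x * (x - of_int \<lfloor>x\<rfloor>)) has_integral g (of_int (k + 1)))
      {of_int k..of_int (k + 1)}"
  proof (rule has_integral_spike_finite[where S = "{of_int (k + 1)}", rotated 2, OF has_integral_eq_rhs])
    fix x :: real assume "x \<in> {of_int k..of_int (k + 1)} - {of_int (k + 1)}"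
    then have "\<lfloor>x\<rfloor> = k" by (intro floor_unique) auto
    then show "g x + g' x * (x - of_int \<lfloor>x\<rfloor>) = g x + g' x * (x - of_int k)" by simp
  qed auto
  have "{a<..k + 1} = insert (k + 1) {a<..k}"
    using step.hyps by auto
  then have "(\<Sum>m\<in>{a<..k + 1}. g (of_int m)) =
      (\<Sum>m\<in>{a<..k}. g (of_int m)) + g (of_int (k + 1))"
    by simp
  then show ?case
    using has_integral_combine[OF _ _ left right] step.hyps by simp
qed

text \<open>The combined integral splits because \<open>g\<close>, being differentiable, is
  continuous and so integrable; the fractional-part term is then integrable as a difference.\<close>

lemma Euler_summation:
  fixes a b :: int and g g' :: "real \<Rightarrow> real"
  assumes "a \<le> b"
    and der: "\<And>x. x \<in> {of_int a..of_int b} \<Longrightarrow>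
           (g has_real_derivative g' x) (at x within {of_int a..of_int b})"
  shows "(\<lambda>x. g' x * (x - of_int \<lfloor>x\<rfloor>)) integrable_on {of_int a..of_int b}" (is ?int)
    and "(\<Sum>m\<in>{a<..b}. g (of_int m)) = integral {of_int a..of_int b} g
           + integral {of_int a..of_int b} (\<lambda>x. g' x * (x - of_int \<lfloor>x\<rfloor>))" (is ?sum)
proof -
  note total = Euler_summation_has_integral[OF assms]
  have g: "g integrable_on {of_int a..of_int b}"
    using der by (intro integrable_continuous_real DERIV_continuous_on)
  show ?int
    using integrable_diff[OF has_integral_integrable[OF total] g] by simp
  then show ?sum
    using integral_unique[OF total] integral_add[OF g] by simp
qed

text \<open>A continuous \<open>h\<close> is the derivative of some \<open>H\<close>, and the
  summation formula for \<open>H\<close> already contains this integrability.\<close>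

lemma integrable_continuous_times_frac:
  fixes a b :: int and h :: "real \<Rightarrow> real"
  assumes "a \<le> b" and "continuous_on {of_int a..of_int b} h"
  shows "(\<lambda>x. h x * (x - of_int \<lfloor>x\<rfloor>)) integrable_on {of_int a..of_int b}"
proof -
  obtain H where "\<And>x. x \<in> {of_int a..of_int b} \<Longrightarrow>
      (H has_vector_derivative h x) (at x within {of_int a..of_int b})"
    using antiderivative_continuous[OF assms(2)] by blast
  then show ?thesis
    using Euler_summation(1)[OF assms(1)]
    unfolding has_real_derivative_iff_has_vector_derivative by blast
qed

text \<open>Differentiability in \<open>x\<close> together with a continuous partial derivative in
  \<open>y\<close> gives a total derivative, and hence joint continuity.\<close>

lemma continuous_partials_imp_continuous_on:
  assumes "continuous_partials_on g gx gy a b c d"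
  shows "continuous_on ({a..b} \<times> {c..d}) (\<lambda>(x, y). g x y)"
proof -
  have cont: "continuous_on ({a..b} \<times> {c..d}) (\<lambda>(x, y). gy x y)"
    using assms by (simp add: continuous_partials_on_def)
  have "((\<lambda>(x, y). g x y) has_derivative (\<lambda>(tx, ty). gx x y * tx + gy x y * ty))
      (at (x, y) within {a..b} \<times> {c..d})" if "x \<in> {a..b}" "y \<in> {c..d}" for x y
  proof -
    have "((\<lambda>(x, y). g x y) has_derivative
        (\<lambda>(tx, ty). gx x y * tx + blinfun_apply (blinfun_mult_right (gy x y)) ty))
        (at (x, y) within {a..b} \<times> {c..d})"
    proof (rule has_derivative_partialsI)
      show "((\<lambda>s. g s y) has_derivative (*) (gx x y)) (at x within {a..b})"
        using assms that by (simp add: continuous_partials_on_def has_field_derivative_def)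
      show "((\<lambda>t. g s t) has_derivative blinfun_apply (blinfun_mult_right (gy s t)))
          (at t within {c..d})" if "s \<in> {a..b}" "t \<in> {c..d}" for s t
        using assms that by (simp add: continuous_partials_on_def has_field_derivative_def)
      have "continuous (at (x, y) within {a..b} \<times> {c..d}) (\<lambda>(x, y). gy x y)"
        using cont that by (simp add: continuous_on_eq_continuous_within)
      then show "continuous (at (x, y) within {a..b} \<times> {c..d})
          (\<lambda>(x, y). blinfun_mult_right (gy x y))"
        using bounded_linear.continuous[OF bounded_linear_blinfun_mult_right]
        by (fastforce simp: case_prod_unfold)
    qed (use that in auto)
    then show ?thesis by simp
  qed
  then show ?thesis
    by (force intro: has_derivative_continuous simp: continuous_on_eq_continuous_within)
qed

lemma continuous_on_integral_snd:
  fixes g :: "real \<Rightarrow> real \<Rightarrow> real"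
  assumes "continuous_on ({a..b} \<times> {c..d}) (\<lambda>(x, y). g x y)"
  shows "continuous_on {a..b} (\<lambda>x. integral {c..d} (g x))"
  using integral_continuous_on_param[of "{a..b}" c d g] assms by (simp add: cbox_interval)

theorem corollary2:
  fixes a b c d :: int
    and f fx fy fxx fxy fyx fyy :: "real \<Rightarrow> real \<Rightarrow> real"
  assumes "a < b" and "c < d"
    and "continuous_partials_on f fx fy (of_int a) (of_int b) (of_int c) (of_int d)"
    and "continuous_partials_on fx fxx fxy (of_int a) (of_int b) (of_int c) (of_int d)"
    and "continuous_partials_on fy fyx fyy (of_int a) (of_int b) (of_int c) (of_int d)"
  shows "(\<Sum>n\<in>{c<..d}. \<Sum>m\<in>{a<..b}. f (of_int m) (of_int n)) =
      integral {of_int a..of_int b} (\<lambda>x. integral {of_int c..of_int d} (\<lambda>y. f x y))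
    + integral {of_int a..of_int b} (\<lambda>x. integral {of_int c..of_int d}
        (\<lambda>y. fx x y * (x - of_int \<lfloor>x\<rfloor>)))
    + integral {of_int a..of_int b} (\<lambda>x. integral {of_int c..of_int d}
        (\<lambda>y. fy x y * (y - of_int \<lfloor>y\<rfloor>)))
    + integral {of_int a..of_int b} (\<lambda>x. integral {of_int c..of_int d}
        (\<lambda>y. fxy x y * (x - of_int \<lfloor>x\<rfloor>) * (y - of_int \<lfloor>y\<rfloor>)))"
proof -
  let ?X = "{real_of_int a..real_of_int b}" and ?Y = "{real_of_int c..real_of_int d}"
  let ?fr = "\<lambda>x::real. x - of_int \<lfloor>x\<rfloor>"
  \<comment> \<open>Primed functions repeat the construction with \<open>fx\<close> and
    \<open>fxy\<close> in place of \<open>f\<close> and \<open>fy\<close>. Of these, only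
    \<open>F'\<close> is treated as a derivative; \<open>A'\<close> and \<open>B'\<close> are just
    the two parts of \<open>F'\<close>.\<close>
  define F where "F = (\<lambda>x. \<Sum>n\<in>{c<..d}. f x (of_int n))"
  define F' where "F' = (\<lambda>x. \<Sum>n\<in>{c<..d}. fx x (of_int n))"
  define A where "A = (\<lambda>x. integral ?Y (f x))"
  define B where "B = (\<lambda>x. integral ?Y (\<lambda>y. fy x y * ?fr y))"
  define A' where "A' = (\<lambda>x. integral ?Y (fx x))"
  define B' where "B' = (\<lambda>x. integral ?Y (\<lambda>y. fxy x y * ?fr y))"
  have ab: "a \<le> b" and cd: "c \<le> d"
    using assms(1,2) by simp_all
  have F: "F x = A x + B x" if "x \<in> ?X" for x
    unfolding F_def A_def B_def
    by (rule Euler_summation(2)[OF cd]) (use assms(3) that in \<open>simp add: continuous_partials_on_def\<close>)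
  have F': "F' x = A' x + B' x" if "x \<in> ?X" for x
    unfolding F'_def A'_def B'_def
    by (rule Euler_summation(2)[OF cd]) (use assms(4) that in \<open>simp add: continuous_partials_on_def\<close>)
  have der: "(F has_real_derivative F' x) (at x within ?X)" if "x \<in> ?X" for x
    unfolding F_def F'_def
    by (rule DERIV_sum) (use assms(3) that in \<open>simp add: continuous_partials_on_def\<close>)
  note outer = Euler_summation[OF ab der]
  have A_int: "A integrable_on ?X"
    unfolding A_def
    by (intro integrable_continuous_real continuous_on_integral_snd
        continuous_partials_imp_continuous_on[OF assms(3)])
  have F_int: "F integrable_on ?X"
    using der by (intro integrable_continuous_real DERIV_continuous_on)
  \<comment> \<open>The integrand of \<open>B\<close> jumps in \<open>y\<close>, so integrability is
    read off from \<open>B = F - A\<close> instead of from continuity in a parameter. The same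
    device serves \<open>B'\<close> below.\<close>
  have B_int: "B integrable_on ?X"
    by (rule integrable_eq[OF integrable_diff[OF F_int A_int]]) (simp add: F)
  have A'_int: "(\<lambda>x. A' x * ?fr x) integrable_on ?X"
    unfolding A'_def
    by (intro integrable_continuous_times_frac ab continuous_on_integral_snd
        continuous_partials_imp_continuous_on[OF assms(4)])
  have B'_int: "(\<lambda>x. B' x * ?fr x) integrable_on ?X"
    by (rule integrable_eq[OF integrable_diff[OF outer(1) A'_int]]) (simp_all add: F' algebra_simps)
  have "integral ?X F = integral ?X (\<lambda>x. A x + B x)"
    by (intro Henstock_Kurzweil_Integration.integral_cong) (simp add: F)
  also have "\<dots> = integral ?X A + integral ?X B"
    by (rule Henstock_Kurzweil_Integration.integral_add[OF A_int B_int])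
  finally have 1: "integral ?X F = integral ?X A + integral ?X B" .
  have "integral ?X (\<lambda>x. F' x * ?fr x) = integral ?X (\<lambda>x. A' x * ?fr x + B' x * ?fr x)"
    by (intro Henstock_Kurzweil_Integration.integral_cong) (simp add: F' distrib_right)
  also have "\<dots> = integral ?X (\<lambda>x. A' x * ?fr x) + integral ?X (\<lambda>x. B' x * ?fr x)"
    by (rule Henstock_Kurzweil_Integration.integral_add[OF A'_int B'_int])
  finally have 2: "integral ?X (\<lambda>x. F' x * ?fr x) =
      integral ?X (\<lambda>x. A' x * ?fr x) + integral ?X (\<lambda>x. B' x * ?fr x)" .
  \<comment> \<open>Moving a factor constant in \<open>y\<close> under the inner integral is valid
    for every real \<open>x\<close>, so these equations can rewrite beneath the outer
    integral.\<close>
  have A'_eq: "A' x * ?fr x = integral ?Y (\<lambda>y. fx x y * ?fr x)" for x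
    by (simp add: A'_def)
  have "B' x * ?fr x = integral ?Y (\<lambda>y. fxy x y * ?fr y * ?fr x)" for x
    by (simp only: B'_def integral_mult_left)
  then have B'_eq: "B' x * ?fr x = integral ?Y (\<lambda>y. fxy x y * ?fr x * ?fr y)" for x
    by (simp only: mult.assoc mult.commute[of "?fr x"])
  have "(\<Sum>n\<in>{c<..d}. \<Sum>m\<in>{a<..b}. f (of_int m) (of_int n)) = (\<Sum>m\<in>{a<..b}. F (of_int m))"
    unfolding F_def by (rule sum.swap)
  also have "\<dots> = integral ?X A + integral ?X (\<lambda>x. A' x * ?fr x) + integral ?X B
      + integral ?X (\<lambda>x. B' x * ?fr x)"
    using outer(2) 1 2 by simp
  finally show ?thesis
    unfolding A'_eq B'_eq unfolding A_def B_def .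
qed

end
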